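(* Let $A$ be a Discoverer algorithm for the source detection game with consistent source behavior on known static graphs. Then there is a Discoverer algorithm $A^u$ for the source detection game with consistent source behavior on unknown static graphs with the following property. If $A$ wins its game within $O(f(n))$ infections with probability $g(n)$, then $A^u$ also wins its game within $O(f(n))$ infections with probability $g(n)$.
   Context: A temporal graph $\mathcal{G}=(V,E,\lambda)$ with lifetime $T_{\max}$ consists of a finite simple undirected graph $(V,E)$, called the underlying static graph, together with a labeling $\lambda\colon E\to\{1,\dots,T_{\max}\}$. The edge $e$ is present only at time $\lambda(e)$. Write $n=|V|$. Infections follow the SIR model with duration $\delta\ge1$. A node may be seed-infected at some time. A susceptible node $u$ becomes infected at time $t$ iff some neighbor $v$ is infectious at time $t$ and $\lambda(uv)=t$; exactly one such neighbor counts as its infector. The node $u$ is then infectious at times $t+1,\dots,t+\delta$ and resistant afterwards. SD game: an Adversary fixes the temporal graph, $T_{\max}$, $\delta$, and a source node $s$. The Discoverer is told $V$, $T_{\max}$, $\delta$, and, in the known-static-graph setting, also $E$ (never $\lambda$); in the unknown-static-graph setting $E$ is not revealed. In each round the Discoverer watches one node. All nodes start susceptible, the source is seed-infected, and an infection chain unfolds. The Discoverer learns whether, when, and by which neighbor the watched node was infected (or that it was the seed). Consistent source behavior means the same seed time and the same infection chain are used in every round. The Discoverer eventually names a node and wins iff it is $s$. The number of infections (price of detection) is the total number of nodes infected, summed over all rounds, until the Discoverer stops. *)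

theory Defs
  imports "HOL-Probability.Probability" "HOL-Library.Landau_Symbols"
begin

locale static_graph =
  fixes V :: "'v set" and E :: "'v set set"
  assumes finite_V: "finite V"
    and edges: "E \<subseteq> {e. e \<subseteq> V \<and> card e = 2}"

locale temporal_graph = static_graph V E
  for V :: "'v set" and E :: "'v set set" +
  fixes lam :: "'v set \<Rightarrow> nat" and Tmax :: nat
  assumes labels: "lam ` E \<subseteq> {1..Tmax}"

text \<open>
  What happens to a node during one round: nothing, a seed infection at the given time,
  or an infection at the given time by the given neighbour.
\<close>

datatype 'v status = Uninfected | Seeded nat | Infected nat 'v

type_synonym 'v chain = "'v \<Rightarrow> 'v status"

fun infected_at :: "'v status \<Rightarrow> nat \<Rightarrow> bool" where
  "infected_at Uninfected t \<longleftrightarrow> False"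
| "infected_at (Seeded t') t \<longleftrightarrow> t = t'"
| "infected_at (Infected t' v) t \<longleftrightarrow> t = t'"

definition infectious :: "nat \<Rightarrow> 'v chain \<Rightarrow> 'v \<Rightarrow> nat \<Rightarrow> bool" where
  "infectious \<delta> c v t \<longleftrightarrow> (\<exists>t'. infected_at (c v) t' \<and> t \<in> {t' + 1..t' + \<delta>})"

definition susceptible :: "'v chain \<Rightarrow> 'v \<Rightarrow> nat \<Rightarrow> bool" where
  "susceptible c u t \<longleftrightarrow> (\<forall>t'<t. \<not> infected_at (c u) t')"

definition can_infect ::
  "'v set set \<Rightarrow> ('v set \<Rightarrow> nat) \<Rightarrow> nat \<Rightarrow> 'v chain \<Rightarrow> 'v \<Rightarrow> 'v \<Rightarrow> nat \<Rightarrow> bool" where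
  "can_infect E lam \<delta> c v u t \<longleftrightarrow> {u, v} \<in> E \<and> lam {u, v} = t \<and> infectious \<delta> c v t"

text \<open>
  The infection times are uniquely determined by the temporal graph and the seed infection;
  the infector is not, if several neighbours can infect a node at the same time.
\<close>

definition infection_chain ::
  "'v set \<Rightarrow> 'v set set \<Rightarrow> ('v set \<Rightarrow> nat) \<Rightarrow> nat \<Rightarrow> 'v \<Rightarrow> nat \<Rightarrow> 'v chain \<Rightarrow> bool" where
  "infection_chain V E lam \<delta> s t\<^sub>0 c \<longleftrightarrow>
     c s = Seeded t\<^sub>0 \<and>
     (\<forall>u. u \<notin> V \<longrightarrow> c u = Uninfected) \<and>
     (\<forall>u \<in> V - {s}.
        (\<forall>t. c u \<noteq> Seeded t) \<and>
        (\<forall>t. infected_at (c u) t \<longleftrightarrow>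
               susceptible c u t \<and> (\<exists>v. can_infect E lam \<delta> c v u t)) \<and>
        (\<forall>t v. c u = Infected t v \<longrightarrow> can_infect E lam \<delta> c v u t))"

text \<open>
  The infection chain of the i-th round is \<open>cs i\<close>. A seed infection at time 0 makes the
  source infectious from the first time step on.
\<close>

locale sd_game = temporal_graph V E lam Tmax
  for V :: "'v set" and E :: "'v set set" and lam :: "'v set \<Rightarrow> nat" and Tmax :: nat +
  fixes \<delta> :: nat and s :: 'v and cs :: "nat \<Rightarrow> 'v chain"
  assumes duration: "\<delta> \<ge> 1"
    and source: "s \<in> V"
    and chains: "\<And>i. \<exists>t\<^sub>0 \<in> {0..Tmax}. infection_chain V E lam \<delta> s t\<^sub>0 (cs i)"

text \<open>The seed time is part of the infection chain.\<close>

definition consistent_source :: "(nat \<Rightarrow> 'v chain) \<Rightarrow> bool" where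
  "consistent_source cs \<longleftrightarrow> (\<forall>i j. cs i = cs j)"

datatype 'v move = Watch 'v | Name 'v

text \<open>The watched nodes with what was observed about them, earliest round first.\<close>

type_synonym 'v history = "('v \<times> 'v status) list"

type_synonym 'v strategy = "'v history \<Rightarrow> 'v move pmf"

text \<open>
  A Discoverer algorithm is a randomized strategy depending on exactly the revealed data:
  \<open>V\<close>, (\<open>E\<close>,) \<open>Tmax\<close>, \<open>\<delta>\<close>.
\<close>

type_synonym 'v known_alg = "'v set \<Rightarrow> 'v set set \<Rightarrow> nat \<Rightarrow> nat \<Rightarrow> 'v strategy"
type_synonym 'v unknown_alg = "'v set \<Rightarrow> nat \<Rightarrow> nat \<Rightarrow> 'v strategy"

definition known_discoverer :: "'v known_alg \<Rightarrow> bool" where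
  "known_discoverer A \<longleftrightarrow>
     (\<forall>V E Tmax \<delta> h. static_graph V E \<and> V \<noteq> {} \<and> \<delta> \<ge> 1 \<longrightarrow>
        set_pmf (A V E Tmax \<delta> h) \<subseteq> Watch ` V \<union> Name ` V)"

definition unknown_discoverer :: "'v unknown_alg \<Rightarrow> bool" where
  "unknown_discoverer A \<longleftrightarrow>
     (\<forall>V Tmax \<delta> h. finite V \<and> V \<noteq> {} \<and> \<delta> \<ge> 1 \<longrightarrow>
        set_pmf (A V Tmax \<delta> h) \<subseteq> Watch ` V \<union> Name ` V)"

text \<open>
  The final history and the named node, when play continues from history \<open>h\<close>; the missing
  mass is the probability that the Discoverer never stops.
\<close>

partial_function (spmf) play ::
  "'v strategy \<Rightarrow> (nat \<Rightarrow> 'v chain) \<Rightarrow> 'v history \<Rightarrow> ('v history \<times> 'v) spmf" where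
  "play \<sigma> cs h =
     bind_spmf (spmf_of_pmf (\<sigma> h))
       (\<lambda>m. case m of
              Watch u \<Rightarrow> play \<sigma> cs (h @ [(u, cs (length h) u)])
            | Name v \<Rightarrow> return_spmf (h, v))"

definition num_infections :: "(nat \<Rightarrow> 'v chain) \<Rightarrow> nat \<Rightarrow> nat" where
  "num_infections cs r = (\<Sum>i<r. card {v. cs i v \<noteq> Uninfected})"

definition win_prob :: "'v strategy \<Rightarrow> (nat \<Rightarrow> 'v chain) \<Rightarrow> 'v \<Rightarrow> real \<Rightarrow> real" where
  "win_prob \<sigma> cs s b =
     measure (measure_spmf (play \<sigma> cs []))
       {(h, v). v = s \<and> real (num_infections cs (length h)) \<le> b}"

definition wins_known :: "'v known_alg \<Rightarrow> (nat \<Rightarrow> real) \<Rightarrow> (nat \<Rightarrow> real) \<Rightarrow> bool" where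
  "wins_known A f g \<longleftrightarrow>
     (\<exists>b \<in> O(f). \<forall>V E lam Tmax \<delta> s cs.
        sd_game V E lam Tmax \<delta> s cs \<and> consistent_source cs \<longrightarrow>
        win_prob (A V E Tmax \<delta>) cs s (b (card V)) \<ge> g (card V))"

definition wins_unknown :: "'v unknown_alg \<Rightarrow> (nat \<Rightarrow> real) \<Rightarrow> (nat \<Rightarrow> real) \<Rightarrow> bool" where
  "wins_unknown A f g \<longleftrightarrow>
     (\<exists>b \<in> O(f). \<forall>V E lam Tmax \<delta> s cs.
        sd_game V E lam Tmax \<delta> s cs \<and> consistent_source cs \<longrightarrow>
        win_prob (A V Tmax \<delta>) cs s (b (card V)) \<ge> g (card V))"

end

theory Submission
  imports Defs
begin

text \<open>
  The unknown-graph algorithm runs \<open>A\<close> on the complete graph with lifetime \<open>Tmax + 1\<close>, reporting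
  every observation one time step later. The delayed chain is a chain of the complete graph in
  which every true edge has its label increased by one and every other edge has label 1: seed
  infections now happen at time 1 at the earliest, so nobody is infectious at time 1 and the
  added edges never transmit.
\<close>

fun delay :: "'v status \<Rightarrow> 'v status" where
  "delay Uninfected = Uninfected"
| "delay (Seeded t) = Seeded (Suc t)"
| "delay (Infected t v) = Infected (Suc t) v"

definition delay_history :: "'v history \<Rightarrow> 'v history" where
  "delay_history = map (map_prod id delay)"

definition complete_edges :: "'v set \<Rightarrow> 'v set set" where
  "complete_edges V = {e. e \<subseteq> V \<and> card e = 2}"

definition delay_labels :: "'v set set \<Rightarrow> ('v set \<Rightarrow> nat) \<Rightarrow> 'v set \<Rightarrow> nat" where
  "delay_labels E lam e = (if e \<in> E then Suc (lam e) else 1)"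

lemma delay_history_Nil [simp]: "delay_history [] = []"
  and delay_history_snoc [simp]:
    "delay_history (h @ [(u, x)]) = delay_history h @ [(u, delay x)]"
  and length_delay_history [simp]: "length (delay_history h) = length h"
  by (simp_all add: delay_history_def)

lemma delay_eq_Uninfected_iff [simp]: "delay x = Uninfected \<longleftrightarrow> x = Uninfected"
  by (cases x) auto

lemma delay_eq_Seeded_iff: "delay x = Seeded t \<longleftrightarrow> (\<exists>t'. t = Suc t' \<and> x = Seeded t')"
  by (cases x) auto

lemma delay_eq_Infected_iff:
  "delay x = Infected t v \<longleftrightarrow> (\<exists>t'. t = Suc t' \<and> x = Infected t' v)"
  by (cases x) auto

lemma infected_at_delay_0 [simp]: "\<not> infected_at (delay x) 0"
  by (cases x) auto

lemma infected_at_delay_Suc [simp]: "infected_at (delay x) (Suc t) \<longleftrightarrow> infected_at x t"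
  by (cases x) auto

lemma not_infectious_0 [simp]: "\<not> infectious \<delta> c v 0"
  by (simp add: infectious_def)

lemma infectious_delay_Suc [simp]:
  "infectious \<delta> (delay \<circ> c) v (Suc t) \<longleftrightarrow> infectious \<delta> c v t"
proof
  assume "infectious \<delta> (delay \<circ> c) v (Suc t)"
  then obtain t' where t': "infected_at (delay (c v)) t'" "Suc t \<in> {t' + 1..t' + \<delta>}"
    by (auto simp: infectious_def)
  then show "infectious \<delta> c v t"
    by (cases t') (auto simp: infectious_def)
next
  assume "infectious \<delta> c v t"
  then obtain t' where "infected_at (c v) t'" "t \<in> {t' + 1..t' + \<delta>}"
    by (auto simp: infectious_def)
  then show "infectious \<delta> (delay \<circ> c) v (Suc t)"
    unfolding infectious_def by (intro exI[of _ "Suc t'"]) auto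
qed

lemma susceptible_delay_Suc [simp]:
  "susceptible (delay \<circ> c) u (Suc t) \<longleftrightarrow> susceptible c u t"
  by (simp add: susceptible_def All_less_Suc2)

lemma not_can_infect_0 [simp]: "\<not> can_infect E lam \<delta> c v u 0"
  by (simp add: can_infect_def)

lemma can_infect_delay_Suc:
  assumes "E \<subseteq> K"
  shows "can_infect K (delay_labels E lam) \<delta> (delay \<circ> c) v u (Suc t)
           \<longleftrightarrow> can_infect E lam \<delta> c v u t"
  using assms by (cases t) (auto simp: can_infect_def delay_labels_def)

lemma infection_chain_delay:
  assumes chain: "infection_chain V E lam \<delta> s t\<^sub>0 c" and "E \<subseteq> K"
  shows "infection_chain V K (delay_labels E lam) \<delta> s (Suc t\<^sub>0) (delay \<circ> c)"
proof -
  note can = can_infect_delay_Suc[OF \<open>E \<subseteq> K\<close>]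
  have "infected_at (delay (c u)) t \<longleftrightarrow> susceptible (delay \<circ> c) u t \<and>
      (\<exists>v. can_infect K (delay_labels E lam) \<delta> (delay \<circ> c) v u t)" if "u \<in> V - {s}" for u t
    using chain that by (cases t) (auto simp: infection_chain_def can)
  then show ?thesis
    using chain
    by (auto simp: infection_chain_def delay_eq_Seeded_iff delay_eq_Infected_iff can)
qed

lemma static_graph_complete_edges: "finite V \<Longrightarrow> static_graph V (complete_edges V)"
  by unfold_locales (auto simp: complete_edges_def)

lemma sd_game_delay:
  assumes "sd_game V E lam Tmax \<delta> s cs"
  shows "sd_game V (complete_edges V) (delay_labels E lam) (Suc Tmax) \<delta> s (\<lambda>i. delay \<circ> cs i)"
proof -
  interpret sd_game V E lam Tmax \<delta> s cs by fact
  interpret K: static_graph V "complete_edges V"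
    by (rule static_graph_complete_edges[OF finite_V])
  have sub: "E \<subseteq> complete_edges V"
    using edges by (simp add: complete_edges_def)
  show ?thesis
  proof
    show "delay_labels E lam ` complete_edges V \<subseteq> {1..Suc Tmax}"
      using labels by (force simp: delay_labels_def)
    show "\<exists>t\<^sub>0\<in>{0..Suc Tmax}. infection_chain V (complete_edges V) (delay_labels E lam) \<delta> s t\<^sub>0
        (delay \<circ> cs i)" for i
    proof -
      obtain t\<^sub>0 where "t\<^sub>0 \<in> {0..Tmax}" "infection_chain V E lam \<delta> s t\<^sub>0 (cs i)"
        using chains by blast
      then show ?thesis
        using infection_chain_delay[OF _ sub] by (intro bexI[of _ "Suc t\<^sub>0"]) auto
    qed
  qed (use duration source in auto)
qed

lemma play_delay:
  "play \<sigma> (\<lambda>i. delay \<circ> cs i) (delay_history h) =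
     map_spmf (apfst delay_history) (play (\<sigma> \<circ> delay_history) cs h)"
proof (induction arbitrary: h rule: play.fixp_induct[case_names adm bot step])
  case adm
  show ?case by simp
next
  case bot
  show ?case by simp
next
  case (step play')
  show ?case
    unfolding map_spmf_bind_spmf o_apply
    by (rule bind_spmf_cong)
      (use step[of "h @ [_]"] in \<open>auto simp: o_def split: move.split\<close>)
qed

lemma num_infections_delay:
  "num_infections (\<lambda>i. delay \<circ> cs i) r = num_infections cs r"
  by (simp add: num_infections_def)

lemma win_prob_delay:
  "win_prob \<sigma> (\<lambda>i. delay \<circ> cs i) s b = win_prob (\<sigma> \<circ> delay_history) cs s b"
  using play_delay[of \<sigma> cs "[]"]
  by (auto simp: win_prob_def num_infections_delay measure_map_spmf
      intro!: arg_cong[where f = "measure (measure_spmf (play (\<sigma> \<circ> delay_history) cs []))"])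

theorem theorem3:
  fixes A :: "'v known_alg"
  assumes "known_discoverer A"
  shows "\<exists>A\<^sub>u :: 'v unknown_alg. unknown_discoverer A\<^sub>u \<and>
           (\<forall>f g :: nat \<Rightarrow> real. wins_known A f g \<longrightarrow> wins_unknown A\<^sub>u f g)"
proof (intro exI conjI allI impI)
  let ?Au = "\<lambda>V Tmax \<delta>. A V (complete_edges V) (Suc Tmax) \<delta> \<circ> delay_history"
  show "unknown_discoverer ?Au"
    using assms static_graph_complete_edges
    unfolding known_discoverer_def unknown_discoverer_def o_def by blast
  fix f g :: "nat \<Rightarrow> real"
  assume "wins_known A f g"
  then obtain b where "b \<in> O(f)" and b: "\<And>V E lam Tmax \<delta> s cs.
      sd_game V E lam Tmax \<delta> s cs \<Longrightarrow> consistent_source cs \<Longrightarrow>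
      g (card V) \<le> win_prob (A V E Tmax \<delta>) cs s (b (card V))"
    unfolding wins_known_def by blast
  have "g (card V) \<le> win_prob (?Au V Tmax \<delta>) cs s (b (card V))"
    if "sd_game V E lam Tmax \<delta> s cs" "consistent_source cs" for V E lam Tmax \<delta> s cs
  proof -
    have "consistent_source (\<lambda>i. delay \<circ> cs i)"
      using that(2) unfolding consistent_source_def by metis
    from b[OF sd_game_delay[OF that(1)] this] show ?thesis
      by (simp add: win_prob_delay)
  qed
  with \<open>b \<in> O(f)\<close> show "wins_unknown ?Au f g"
    unfolding wins_unknown_def by blast
qed

end
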